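(* Let $(X,M,f,\alpha,\star)$ be a fuzzy $\mathscr{F}$-metric space. Every compact subset $A\subset X$ is complete.
   Context: A continuous $t$-norm is a continuous map $\star:[0,1]\times[0,1]\to[0,1]$ that is associative, commutative, satisfies $a\star 1=a$ for all $a$, and $a\star c\le b\star d$ whenever $a\le b$ and $c\le d$. $\mathscr{F}$ is the set of functions $f:[0,1]\to[0,1]$ such that (1) $f$ is strictly increasing on $[0,1)$; (2) for every sequence $(t_n)$ in $[0,1]$, $\lim_n t_n=1$ if and only if $\lim_n f(t_n)=1$. A fuzzy $\mathscr{F}$-metric space $(X,M,f,\alpha,\star)$ consists of a nonempty set $X$, a continuous $t$-norm $\star$, a pair $(f,\alpha)\in\mathscr{F}\times(0,1]$ and a map $M:X\times X\times(0,\infty)\to[0,1]$ such that for all $x,y\in X$ and $t>0$: (i) $M(x,y,t)>0$; (ii) $M(x,y,s)=1$ for all $s>0$ if and only if $x=y$; (iii) $M(x,y,t)=M(y,x,t)$; (iv) for every integer $N\ge 2$, all $u_1,\dots,u_N\in X$ with $u_1=x$, $u_N=y$, and all $t_1,\dots,t_{N-1}>0$ with $t=t_1+\cdots+t_{N-1}$, if $M(x,y,t)<1$ then $(f(M(x,y,t)))^{\alpha}\ge f\big(M(u_1,u_2,t_1)\star\cdots\star M(u_{N-1},u_N,t_{N-1})\big)$. A sequence $(x_n)$ in $X$ is $\mathscr{F}$-convergent to $x\in X$ if $\lim_{n\to\infty}M(x_n,x,t)=1$ for all $t>0$, and is $\mathscr{F}$-Cauchy if $\lim_{m,n\to\infty}M(x_n,x_m,t)=1$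 for all $t>0$. A subset $A\subset X$ is compact if every sequence in $A$ has a subsequence that $\mathscr{F}$-converges to some point of $A$. $A$ is complete if every $\mathscr{F}$-Cauchy sequence in $A$ is $\mathscr{F}$-convergent to some point of $A$. *)

theory Defs
  imports "HOL-Analysis.Analysis"
begin

text \<open>Functions on the unit interval are total functions on the reals; every axiom constrains
  only their values on the unit interval. Likewise \<open>M x y t\<close> is relevant only for
  \<open>x, y \<in> X\<close> and \<open>t > 0\<close>.\<close>

locale continuous_t_norm =
  fixes T :: "real \<Rightarrow> real \<Rightarrow> real"  (infixl "\<star>" 70)
  assumes range: "\<lbrakk>a \<in> {0..1}; b \<in> {0..1}\<rbrakk> \<Longrightarrow> a \<star> b \<in> {0..1}"
    and continuous: "continuous_on ({0..1} \<times> {0..1}) (\<lambda>(a, b). a \<star> b)"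
    and assoc: "\<lbrakk>a \<in> {0..1}; b \<in> {0..1}; c \<in> {0..1}\<rbrakk> \<Longrightarrow> (a \<star> b) \<star> c = a \<star> (b \<star> c)"
    and commute: "\<lbrakk>a \<in> {0..1}; b \<in> {0..1}\<rbrakk> \<Longrightarrow> a \<star> b = b \<star> a"
    and right_one: "a \<in> {0..1} \<Longrightarrow> a \<star> 1 = a"
    and mono: "\<lbrakk>a \<in> {0..1}; b \<in> {0..1}; c \<in> {0..1}; d \<in> {0..1}; a \<le> b; c \<le> d\<rbrakk>
      \<Longrightarrow> a \<star> c \<le> b \<star> d"

definition class_F :: "(real \<Rightarrow> real) set" where
  "class_F = {f. f \<in> {0..1} \<rightarrow> {0..1} \<and> strict_mono_on {0..<1} f \<and>
    (\<forall>t :: nat \<Rightarrow> real. (\<forall>n. t n \<in> {0..1}) \<longrightarrow>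
      (t \<longlonglongrightarrow> 1 \<longleftrightarrow> (\<lambda>n. f (t n)) \<longlonglongrightarrow> 1))}"

text \<open>In the last axiom the \<open>foldl\<close> term is the product
  \<open>M (u 1) (u 2) (s 1) \<star> \<dots> \<star> M (u (N - 1)) (u N) (s (N - 1))\<close>, bracketed to the left; for
  \<open>N = 2\<close> it is its first factor alone. Since \<open>\<alpha> > 0\<close>, the convention \<open>0 powr \<alpha> = 0\<close> is the
  usual value of the power.\<close>

locale fuzzy_F_metric_space = continuous_t_norm T
  for T :: "real \<Rightarrow> real \<Rightarrow> real"  (infixl "\<star>" 70) +
  fixes X :: "'a set"
    and M :: "'a \<Rightarrow> 'a \<Rightarrow> real \<Rightarrow> real"
    and f :: "real \<Rightarrow> real"
    and \<alpha> :: real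
  assumes nonempty: "X \<noteq> {}"
    and f_class: "f \<in> class_F"
    and alpha: "\<alpha> \<in> {0<..1}"
    and M_range: "\<lbrakk>x \<in> X; y \<in> X; t > 0\<rbrakk> \<Longrightarrow> M x y t \<in> {0..1}"
    and M_pos: "\<lbrakk>x \<in> X; y \<in> X; t > 0\<rbrakk> \<Longrightarrow> M x y t > 0"
    and M_eq_one_iff: "\<lbrakk>x \<in> X; y \<in> X\<rbrakk> \<Longrightarrow> (\<forall>s>0. M x y s = 1) \<longleftrightarrow> x = y"
    and M_sym: "\<lbrakk>x \<in> X; y \<in> X; t > 0\<rbrakk> \<Longrightarrow> M x y t = M y x t"
    and M_chain: "\<And>x y t (N :: nat) (u :: nat \<Rightarrow> 'a) (s :: nat \<Rightarrow> real).
      \<lbrakk>x \<in> X; y \<in> X; t > 0; N \<ge> 2; \<forall>i\<in>{1..N}. u i \<in> X; u 1 = x; u N = y;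
       \<forall>i\<in>{1..N - 1}. s i > 0; t = (\<Sum>i=1..N - 1. s i); M x y t < 1\<rbrakk>
      \<Longrightarrow> (f (M x y t)) powr \<alpha> \<ge>
        f (foldl (\<star>) (M (u 1) (u 2) (s 1)) (map (\<lambda>i. M (u i) (u (Suc i)) (s i)) [2..<N]))"

definition F_convergent :: "('a \<Rightarrow> 'a \<Rightarrow> real \<Rightarrow> real) \<Rightarrow> (nat \<Rightarrow> 'a) \<Rightarrow> 'a \<Rightarrow> bool" where
  "F_convergent M x l \<longleftrightarrow> (\<forall>t>0. (\<lambda>n. M (x n) l t) \<longlonglongrightarrow> 1)"

definition F_Cauchy :: "('a \<Rightarrow> 'a \<Rightarrow> real \<Rightarrow> real) \<Rightarrow> (nat \<Rightarrow> 'a) \<Rightarrow> bool" where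
  "F_Cauchy M x \<longleftrightarrow>
    (\<forall>t>0. ((\<lambda>(m, n). M (x n) (x m) t) \<longlongrightarrow> 1) (sequentially \<times>\<^sub>F sequentially))"

definition F_compact :: "('a \<Rightarrow> 'a \<Rightarrow> real \<Rightarrow> real) \<Rightarrow> 'a set \<Rightarrow> bool" where
  "F_compact M A \<longleftrightarrow> (\<forall>x :: nat \<Rightarrow> 'a. (\<forall>n. x n \<in> A) \<longrightarrow>
    (\<exists>l\<in>A. \<exists>r :: nat \<Rightarrow> nat. strict_mono r \<and> F_convergent M (x \<circ> r) l))"

definition F_complete :: "('a \<Rightarrow> 'a \<Rightarrow> real \<Rightarrow> real) \<Rightarrow> 'a set \<Rightarrow> bool" where
  "F_complete M A \<longleftrightarrow> (\<forall>x :: nat \<Rightarrow> 'a. (\<forall>n. x n \<in> A) \<and> F_Cauchy M x \<longrightarrow>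
    (\<exists>l\<in>A. F_convergent M x l))"

end

theory Submission
  imports Defs
begin

text \<open>A Cauchy sequence with a convergent subsequence converges to the limit of that subsequence,
  exactly as in a metric space, once the triangle inequality has a limit form: if
  \<open>M (u n) (v n) s\<close> and \<open>M (v n) (w n) t\<close> tend to \<open>1\<close>, then so does \<open>M (u n) (w n) (s + t)\<close>.
  This is lemma \<open>tendsto_one_triangle\<close>. It comes from the chain axiom for one intermediate point:
  by continuity of the t-norm and \<open>1 \<star> 1 = 1\<close> the product of the two closeness values tends to
  \<open>1\<close>, the class of \<open>f\<close> carries such limits through \<open>f\<close> in both directions, and the exponent
  \<open>\<alpha>\<close>, being a positive constant, can be moved to the other side of the inequality and does
  not affect convergence to \<open>1\<close>.

  For a Cauchy sequence \<open>x\<close> and a subsequence \<open>x \<circ> r\<close> converging to \<open>l\<close>, the limit form is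
  applied with \<open>u n = x n\<close>, \<open>v n = x (r n)\<close> and \<open>w n = l\<close>.\<close>

lemma class_F_at_one:
  assumes "f \<in> class_F"
  shows "f 1 = 1"
proof -
  \<comment> \<open>The sequential condition for the constant sequence \<open>1\<close>.\<close>
  have "((\<lambda>n::nat. 1::real) \<longlonglongrightarrow> 1) \<longleftrightarrow> (\<lambda>n::nat. f 1) \<longlonglongrightarrow> 1"
    using assms unfolding class_F_def by (auto dest!: spec[of _ "\<lambda>n::nat. 1::real"])
  then show ?thesis
    by (simp add: LIMSEQ_const_iff)
qed

lemma class_F_range:
  assumes "f \<in> class_F" "t \<in> {0..1}"
  shows "f t \<in> {0..1}"
  using assms unfolding class_F_def by blast

lemma class_F_tendsto_one_iff:
  fixes t :: "nat \<Rightarrow> real"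
  assumes "f \<in> class_F" "\<And>n. t n \<in> {0..1}"
  shows "(\<lambda>n. f (t n)) \<longlonglongrightarrow> 1 \<longleftrightarrow> t \<longlonglongrightarrow> 1"
  using assms unfolding class_F_def by blast

lemma (in continuous_t_norm) tendsto_one:
  assumes "\<And>n. a n \<in> {0..1}" "\<And>n. b n \<in> {0..1}" "a \<longlonglongrightarrow> 1" "b \<longlonglongrightarrow> 1"
  shows "(\<lambda>n. a n \<star> b n) \<longlonglongrightarrow> 1"
proof -
  have "(\<lambda>n. (\<lambda>(c, d). c \<star> d) (a n, b n)) \<longlonglongrightarrow> (\<lambda>(c, d). c \<star> d) (1, 1)"
    by (rule continuous_on_tendsto_compose[OF continuous])
      (use assms in \<open>auto intro: tendsto_Pair\<close>)
  then show ?thesis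
    using right_one[of 1] by simp
qed

context fuzzy_F_metric_space
begin

lemma triangle:
  assumes "x \<in> X" "y \<in> X" "z \<in> X" "s > 0" "t > 0" "M x z (s + t) < 1"
  shows "f (M x y s \<star> M y z t) \<le> f (M x z (s + t)) powr \<alpha>"
proof -
  let ?u = "\<lambda>i::nat. if i = 1 then x else if i = 2 then y else z"
  let ?s = "\<lambda>i::nat. if i = 1 then s else t"
  have "f (M x z (s + t)) powr \<alpha> \<ge>
    f (foldl (\<star>) (M (?u 1) (?u 2) (?s 1)) (map (\<lambda>i. M (?u i) (?u (Suc i)) (?s i)) [2..<3]))"
    by (rule M_chain[where u = ?u and s = ?s and N = 3])
      (use assms in \<open>auto simp: numeral_2_eq_2\<close>)
  moreover have "[2..<3::nat] = [2]"
    by (simp add: upt_rec)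
  ultimately show ?thesis
    by simp
qed

text \<open>Taking the root of order \<open>\<alpha>\<close> isolates \<open>f (M x z (s + t))\<close>, and the restriction to values
  below \<open>1\<close> disappears because \<open>f 1 = 1\<close> is the largest value of \<open>f\<close>.\<close>

lemma triangle_root:
  assumes "x \<in> X" "y \<in> X" "z \<in> X" "s > 0" "t > 0"
  shows "f (M x y s \<star> M y z t) powr (1 / \<alpha>) \<le> f (M x z (s + t))"
proof -
  have *: "f (M x y s \<star> M y z t) \<in> {0..1}" "f (M x z (s + t)) \<in> {0..1}"
    using assms by (simp_all only: class_F_range[OF f_class] range M_range add_pos_pos)
  show ?thesis
  proof (cases "M x z (s + t) < 1")
    case True
    have "f (M x y s \<star> M y z t) powr (1 / \<alpha>) \<le> (f (M x z (s + t)) powr \<alpha>) powr (1 / \<alpha>)"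
      using triangle[OF assms True] * alpha by (intro powr_mono2) auto
    also have "\<dots> = f (M x z (s + t))"
      using * alpha by (simp add: powr_powr)
    finally show ?thesis .
  next
    case False
    then have "M x z (s + t) = 1"
      using M_range[of x z "s + t"] assms by simp
    then show ?thesis
      using * alpha class_F_at_one[OF f_class] by (simp add: powr_le1)
  qed
qed

lemma tendsto_one_triangle:
  fixes u v w :: "nat \<Rightarrow> 'a"
  assumes X: "\<And>n. u n \<in> X" "\<And>n. v n \<in> X" "\<And>n. w n \<in> X" and pos: "s > 0" "t > 0"
    and uv: "(\<lambda>n. M (u n) (v n) s) \<longlonglongrightarrow> 1" and vw: "(\<lambda>n. M (v n) (w n) t) \<longlonglongrightarrow> 1"
  shows "(\<lambda>n. M (u n) (w n) (s + t)) \<longlonglongrightarrow> 1"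
proof -
  let ?p = "\<lambda>n. M (u n) (v n) s \<star> M (v n) (w n) t"
  have uw: "M (u n) (w n) (s + t) \<in> {0..1}" for n
    using X pos by (intro M_range) auto
  have "(\<lambda>n. f (?p n)) \<longlonglongrightarrow> 1"
    using class_F_tendsto_one_iff[OF f_class, of ?p] X pos uv vw
    by (simp only: range M_range tendsto_one)
  then have "(\<lambda>n. f (?p n) powr (1 / \<alpha>)) \<longlonglongrightarrow> 1 powr (1 / \<alpha>)"
    by (intro tendsto_powr tendsto_const) auto
  then have lower: "(\<lambda>n. f (?p n) powr (1 / \<alpha>)) \<longlonglongrightarrow> 1"
    by simp
  have "(\<lambda>n. f (M (u n) (w n) (s + t))) \<longlonglongrightarrow> 1"
  proof (rule tendsto_sandwich[OF _ _ lower tendsto_const])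
    show "\<forall>\<^sub>F n in sequentially. f (?p n) powr (1 / \<alpha>) \<le> f (M (u n) (w n) (s + t))"
      using triangle_root[OF X pos] by simp
    show "\<forall>\<^sub>F n in sequentially. f (M (u n) (w n) (s + t)) \<le> 1"
      using class_F_range[OF f_class uw] by simp
  qed
  then show ?thesis
    using class_F_tendsto_one_iff[OF f_class, of "\<lambda>n. M (u n) (w n) (s + t)"] uw by blast
qed

lemma F_Cauchy_imp_F_convergent:
  assumes X: "\<And>n. x n \<in> X" "l \<in> X" and "F_Cauchy M x"
    and r: "strict_mono r" "F_convergent M (x \<circ> r) l"
  shows "F_convergent M x l"
  unfolding F_convergent_def
proof (intro allI impI)
  fix t :: real
  assume t: "t > 0"
  have r_top: "filterlim r sequentially sequentially"
    by (rule filterlim_subseq[OF r(1)])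
  have "((\<lambda>(m, n). M (x n) (x m) (t / 2)) \<longlongrightarrow> 1) (sequentially \<times>\<^sub>F sequentially)"
    using \<open>F_Cauchy M x\<close> t unfolding F_Cauchy_def by simp
  \<comment> \<open>The Cauchy condition is restricted to the index pairs \<open>(r n, n)\<close>.\<close>
  from filterlim_compose[OF this filterlim_Pair[OF r_top filterlim_ident]]
  have "(\<lambda>n. M (x n) (x (r n)) (t / 2)) \<longlonglongrightarrow> 1"
    by simp
  moreover have "(\<lambda>n. M (x (r n)) l (t / 2)) \<longlonglongrightarrow> 1"
    using r(2) t unfolding F_convergent_def by simp
  ultimately have "(\<lambda>n. M (x n) l (t / 2 + t / 2)) \<longlonglongrightarrow> 1"
    using X t by (intro tendsto_one_triangle[where v = "\<lambda>n. x (r n)"]) auto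
  then show "(\<lambda>n. M (x n) l t) \<longlonglongrightarrow> 1"
    by simp
qed

end

theorem theorem3p5:
  fixes T :: "real \<Rightarrow> real \<Rightarrow> real"
    and X A :: "'a set"
    and M :: "'a \<Rightarrow> 'a \<Rightarrow> real \<Rightarrow> real"
    and f :: "real \<Rightarrow> real"
    and \<alpha> :: real
  assumes "fuzzy_F_metric_space T X M f \<alpha>"
    and "A \<subseteq> X"
    and "F_compact M A"
  shows "F_complete M A"
  unfolding F_complete_def
proof (intro allI impI)
  fix x :: "nat \<Rightarrow> 'a"
  assume x: "(\<forall>n. x n \<in> A) \<and> F_Cauchy M x"
  then obtain l r where "l \<in> A" "strict_mono r" "F_convergent M (x \<circ> r) l"
    using \<open>F_compact M A\<close> unfolding F_compact_def by blast
  moreover from this have "F_convergent M x l"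
    using fuzzy_F_metric_space.F_Cauchy_imp_F_convergent[OF assms(1)] x \<open>A \<subseteq> X\<close> by blast
  ultimately show "\<exists>l\<in>A. F_convergent M x l"
    by blast
qed

end
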